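(* There is a constant $c>0$ such that the following holds. Let $\boldsymbol{\omega}=(\omega_1,\omega_2,\ldots)$ be a nondecreasing sequence of positive numbers tending to $+\infty$, and let $\mu_{\boldsymbol{\omega}}$ be the probability measure on sequences of positive integers defined in the context. Then $\mu_{\boldsymbol{\omega}}$-almost every sequence $(n_k)_{k\ge 1}$ satisfies Condition $\boldsymbol{A_{\omega^*}}$ with $$\boldsymbol{\omega^*}=(c\,\omega_1^{1/2},\ c\,\omega_2^{1/2},\ \ldots).$$
   Context: The measure $\mu_{\boldsymbol{\omega}}$: put $$I_k=[\,a(k-1)^{\omega_{k-1}},\ a k^{\omega_k}),\qquad k=1,2,\ldots,$$ with $I_1=[0,a)$, where $a>0$ is a fixed constant large enough that each $I_k$ contains at least one positive integer. Choose $n_1,n_2,\ldots$ independently, with $n_k$ uniformly distributed on the set of positive integers in $I_k$. Then $\mu_{\boldsymbol{\omega}}$ is the distribution of the random sequence $(n_k)_{k\ge 1}$ in the product space $I_1\times I_2\times\cdots$. Condition $\boldsymbol{A_\eta}$: given a nondecreasing sequence $\boldsymbol{\eta}=(\eta_1,\eta_2,\ldots)$ of positive numbers tending to $+\infty$, a sequence $(n_k)_{k\ge 1}$ of different positive integers satisfies Condition $\boldsymbol{A_\eta}$ if there is an $N_0$ such that for every $N\ge N_0$ the following holds: whenever $r$ is an integer with $2\le r\le\eta_N$, the indices $k_1,\ldots,k_r$ are pairwise different, and $a_1,\ldots,a_r$ are nonzero integers with $0<|a_1|,\ldots,|a_r|\le N^{\eta_N}$ such that $$a_1n_{k_1}+\cdots+a_rn_{k_r}=0,$$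 then all of $n_{k_1},\ldots,n_{k_r}$ belong to the set of the $N$ smallest elements of the sequence $(n_k)_{k\ge 1}$. *)

theory Defs
  imports "HOL-Probability.Probability" "HOL-Library.Infinite_Set"
begin

text \<open>
  Sequences are functions on \<^typ>\<open>nat\<close> of which only the values at indices \<open>k \<ge> 1\<close> matter.
\<close>

definition growth_seq :: "(nat \<Rightarrow> real) \<Rightarrow> bool" where
  "growth_seq \<eta> \<longleftrightarrow>
     mono_on {1..} \<eta> \<and> (\<forall>k\<ge>1. \<eta> k > 0) \<and> filterlim \<eta> at_top sequentially"

definition block :: "real \<Rightarrow> (nat \<Rightarrow> real) \<Rightarrow> nat \<Rightarrow> real set" where
  "block a \<omega> k =
     (if k = 1 then {0..<a}
      else {a * real (k - 1) powr \<omega> (k - 1) ..< a * real k powr \<omega> k})"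

definition block_ints :: "real \<Rightarrow> (nat \<Rightarrow> real) \<Rightarrow> nat \<Rightarrow> nat set" where
  "block_ints a \<omega> k = {m. m > 0 \<and> real m \<in> block a \<omega> k}"

definition mu :: "real \<Rightarrow> (nat \<Rightarrow> real) \<Rightarrow> (nat \<Rightarrow> nat) measure" where
  "mu a \<omega> = PiM {1..} (\<lambda>k. uniform_count_measure (block_ints a \<omega> k))"

text \<open>
  Intended for infinite \<open>S\<close>; \<^const>\<open>enumerate\<close> lists \<open>S\<close> increasingly, starting at index 0.
\<close>

definition smallest_elems :: "nat \<Rightarrow> nat set \<Rightarrow> nat set" where
  "smallest_elems N S = enumerate S ` {..<N}"

text \<open>Intended for \<open>\<eta>\<close> with \<^term>\<open>growth_seq \<eta>\<close>.\<close>

definition condition_A :: "(nat \<Rightarrow> real) \<Rightarrow> (nat \<Rightarrow> nat) \<Rightarrow> bool" where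
  "condition_A \<eta> n \<longleftrightarrow>
     inj_on n {1..} \<and> (\<forall>k\<ge>1. n k > 0) \<and>
     (\<exists>N0\<ge>1. \<forall>N\<ge>N0. \<forall>(r::nat) (k :: nat \<Rightarrow> nat) (a :: nat \<Rightarrow> int).
        2 \<le> r \<longrightarrow> real r \<le> \<eta> N \<longrightarrow>
        (\<forall>i\<in>{1..r}. k i \<ge> 1) \<longrightarrow> inj_on k {1..r} \<longrightarrow>
        (\<forall>i\<in>{1..r}. 0 < \<bar>a i\<bar> \<and> real_of_int \<bar>a i\<bar> \<le> real N powr \<eta> N) \<longrightarrow>
        (\<Sum>i=1..r. a i * int (n (k i))) = 0 \<longrightarrow>
        (\<forall>i\<in>{1..r}. n (k i) \<in> smallest_elems N (n ` {1..})))"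

end

theory Submission
  imports Defs
begin

text \<open>
  The blocks are consecutive, so \<open>n\<close> is strictly increasing and the \<open>N\<close> smallest elements are
  \<open>n\<^sub>1, \<dots>, n\<^sub>N\<close>.  A relation violating the condition at stage \<open>N\<close> therefore has a largest index
  \<open>K > N\<close>, and since \<open>\<eta>\<close> is nondecreasing it also respects the bounds of stage \<open>K\<close>.  Once the
  coefficients and the other terms are fixed, at most one value of \<open>n\<^sub>K\<close> satisfies it.  With
  \<open>w = \<omega>\<^sub>K\<close> and \<open>c = 1/2\<close> there are at most \<open>K\<close> to the power \<open>w/4 + O(sqrt w)\<close> choices of indices and
  coefficients, against at least \<open>K\<close> to the power \<open>w - 2\<close> values of \<open>n\<^sub>K\<close>; Borel-Cantelli applies.
\<close>

subsection \<open>The probability of one linear relation\<close>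

text \<open>The term of index \<open>K\<close> is kept apart because its value is the one left free
  when all others are fixed. Lists of pairs encode the remaining terms so that, over finite sets of
  indices and coefficients, those of a given length are easy to count.\<close>

definition relation_event ::
  "(nat \<Rightarrow> nat) measure \<Rightarrow> nat \<Rightarrow> (nat \<times> int) list \<Rightarrow> int \<Rightarrow> (nat \<Rightarrow> nat) set" where
  "relation_event P K xs b =
     {n \<in> space P. (\<Sum>(k, d)\<leftarrow>xs. d * int (n k)) + b * int (n K) = 0}"

text \<open>Each summand depends on one coordinate, and every function on a uniform counting space
  is measurable. The cast to the reals makes closure of Borel functions under addition
  available.\<close>

lemma sum_list_component_measurable:
  fixes B :: "nat \<Rightarrow> nat set" and I :: "nat set"
  assumes "fst ` set xs \<subseteq> I"
  shows "(\<lambda>n. real_of_int (\<Sum>(k, d)\<leftarrow>xs. d * int (n k)))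
           \<in> borel_measurable (PiM I (\<lambda>k. uniform_count_measure (B k)))"
  using assms
proof (induction xs)
  case Nil
  then show ?case by simp
next
  case (Cons p xs)
  obtain k d where p: "p = (k, d)" by fastforce
  have "k \<in> I" using Cons.prems p by auto
  have "(\<lambda>x. real_of_int (d * int x)) \<in> borel_measurable (uniform_count_measure (B k))"
    by (simp add: measurable_def sets_uniform_count_measure space_uniform_count_measure)
  from measurable_compose[OF
      measurable_component_singleton[of k I "\<lambda>k. uniform_count_measure (B k)"] this] \<open>k \<in> I\<close>
  have "(\<lambda>n. real_of_int (d * int (n k)))
      \<in> borel_measurable (PiM I (\<lambda>k. uniform_count_measure (B k)))" by simp
  moreover have "(\<lambda>n. real_of_int (\<Sum>(k, d)\<leftarrow>xs. d * int (n k)))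
           \<in> borel_measurable (PiM I (\<lambda>k. uniform_count_measure (B k)))"
    using Cons by auto
  ultimately show ?case
    unfolding p by (simp only: list.map sum_list.Cons case_prod_conv of_int_add borel_measurable_add)
qed

lemma sets_relation_event:
  fixes B :: "nat \<Rightarrow> nat set" and I :: "nat set"
  defines "P \<equiv> PiM I (\<lambda>k. uniform_count_measure (B k))"
  assumes "fst ` set xs \<subseteq> I" "K \<in> I"
  shows "relation_event P K xs b \<in> sets P"
proof -
  have "(\<lambda>n. real_of_int (\<Sum>(k, d)\<leftarrow>((K, b) # xs). d * int (n k))) \<in> borel_measurable P"
    unfolding P_def using assms by (intro sum_list_component_measurable) auto
  then have "{n \<in> space P. real_of_int (\<Sum>(k, d)\<leftarrow>((K, b) # xs). d * int (n k)) = 0} \<in> sets P"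
    by measurable
  also have "{n \<in> space P. real_of_int (\<Sum>(k, d)\<leftarrow>((K, b) # xs). d * int (n k)) = 0}
      = relation_event P K xs b"
    unfolding relation_event_def of_int_eq_0_iff by (simp add: add.commute)
  finally show ?thesis .
qed

text \<open>By Fubini it is enough to fix all coordinates except \<open>K\<close>. What remains is a
  linear equation in \<open>n K\<close> with nonzero leading coefficient \<open>b\<close>, so at
  most one of the \<open>card (B K)\<close> equally likely values solves it.\<close>

lemma emeasure_relation_event_le:
  fixes B :: "nat \<Rightarrow> nat set" and I :: "nat set"
  defines "P \<equiv> PiM I (\<lambda>k. uniform_count_measure (B k))"
  assumes B: "\<And>k. k \<in> I \<Longrightarrow> finite (B k) \<and> B k \<noteq> {}"
    and xs: "fst ` set xs \<subseteq> I - {K}" and K: "K \<in> I" and b: "b \<noteq> 0"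
  shows "emeasure P (relation_event P K xs b) \<le> ennreal (1 / card (B K))"
proof -
  define M where "M = (\<lambda>k. uniform_count_measure (B k))"
  define Q where "Q = PiM (I - {K}) M"
  let ?E = "relation_event P K xs b"
  have prob: "prob_space (M k)" if "k \<in> I" for k
    unfolding M_def using B[OF that] by (intro prob_space_uniform_count_measure) auto
  interpret MK: prob_space "M K" by (rule prob[OF K])
  interpret Q: prob_space Q unfolding Q_def by (intro prob_space_PiM prob) auto
  interpret pair_sigma_finite "M K" Q ..
  let ?f = "\<lambda>(x, X :: nat \<Rightarrow> nat). X(K := x)"
  have ins: "insert K (I - {K}) = I" using K by auto
  \<comment> \<open>Independence enters here: inserting a coordinate drawn from \<open>M K\<close>
    into a point drawn from \<open>Q\<close> reproduces \<open>P\<close>.\<close>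
  have P: "P = distr (M K \<Otimes>\<^sub>M Q) P ?f"
    using distr_pair_PiM_eq_PiM[of "I - {K}" M K] prob K
    unfolding P_def Q_def ins M_def by simp
  have f: "?f \<in> measurable (M K \<Otimes>\<^sub>M Q) P"
    using measurable_fun_upd[of I "I - {K}" K snd "M K \<Otimes>\<^sub>M Q" M fst] K
    unfolding P_def Q_def M_def split_def by auto
  have E: "?E \<in> sets P"
    unfolding P_def using xs K by (intro sets_relation_event) auto
  define F where "F = ?f -` ?E \<inter> space (M K \<Otimes>\<^sub>M Q)"
  have F: "F \<in> sets (M K \<Otimes>\<^sub>M Q)"
    unfolding F_def using f E by (rule measurable_sets)
  have "emeasure P ?E = emeasure (M K \<Otimes>\<^sub>M Q) F"
    unfolding F_def by (subst P) (rule emeasure_distr[OF f E])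
  also have "\<dots> = (\<integral>\<^sup>+X. emeasure (M K) ((\<lambda>x. (x, X)) -` F) \<partial>Q)"
    using F by (rule emeasure_pair_measure_alt2)
  also have "\<dots> \<le> (\<integral>\<^sup>+X. ennreal (1 / card (B K)) \<partial>Q)"
  proof (rule nn_integral_mono)
    fix X
    let ?S = "(\<lambda>x. (x, X)) -` F"
    have S: "?S \<subseteq> B K"
      by (auto simp: F_def space_pair_measure M_def space_uniform_count_measure)
    have "x = y" if "x \<in> ?S" "y \<in> ?S" for x y
    proof -
      have "(\<Sum>(k, d)\<leftarrow>xs. d * int (X k)) + b * int z = 0" if "z \<in> ?S" for z
      proof -
        \<comment> \<open>The list \<open>xs\<close> avoids the index \<open>K\<close>, so changing
          coordinate \<open>K\<close> leaves its sum unchanged.\<close>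
        have "map (\<lambda>(k, d). d * int ((X(K := z)) k)) xs = map (\<lambda>(k, d). d * int (X k)) xs"
          using xs by (intro map_cong refl) fastforce
        moreover have "(\<Sum>(k, d)\<leftarrow>xs. d * int ((X(K := z)) k)) + b * int ((X(K := z)) K) = 0"
          using that unfolding F_def relation_event_def
          by (simp only: vimage_eq Int_iff mem_Collect_eq case_prod_conv)
        ultimately show ?thesis by (simp only: fun_upd_same)
      qed
      from this[OF that(1)] this[OF that(2)] have "b * int x = b * int y" by linarith
      with b show ?thesis by simp
    qed
    moreover have "finite ?S" using S B[OF K] by (meson finite_subset)
    ultimately have "card ?S \<le> 1" by (simp add: card_le_Suc0_iff_eq)
    then have "real (card ?S) / card (B K) \<le> 1 / card (B K)"
      by (intro divide_right_mono) auto
    then show "emeasure (M K) ?S \<le> ennreal (1 / card (B K))"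
      unfolding M_def using S B[OF K] by (subst emeasure_uniform_count_measure) auto
  qed
  also have "\<dots> = ennreal (1 / card (B K))"
    by (simp add: Q.emeasure_space_1)
  finally show ?thesis .
qed

text \<open>Union bound: there are \<open>(card J * card C) ^ R\<close> lists and at most
  \<open>card C\<close> leading coefficients, and each resulting relation has probability at most
  \<open>1 / card (B K)\<close>.\<close>

lemma emeasure_Union_relation_event_le:
  fixes B :: "nat \<Rightarrow> nat set" and I J :: "nat set" and C :: "int set"
  defines "P \<equiv> PiM I (\<lambda>k. uniform_count_measure (B k))"
  assumes B: "\<And>k. k \<in> I \<Longrightarrow> finite (B k) \<and> B k \<noteq> {}"
    and J: "J \<subseteq> I - {K}" "finite J" and K: "K \<in> I" and C: "finite C" "0 \<in> C"
  shows "emeasure P (\<Union>xs\<in>{xs. set xs \<subseteq> J \<times> C \<and> length xs = R}. \<Union>b\<in>C - {0}.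
             relation_event P K xs b)
           \<le> ennreal (real ((card J * card C) ^ R * card C) / card (B K))"
    (is "emeasure P ?E \<le> _")
proof -
  let ?L = "{xs. set xs \<subseteq> J \<times> C \<and> length xs = R}"
  let ?T = "?L \<times> (C - {0})"
  have cardL: "card ?L = (card J * card C) ^ R"
    using J C by (simp add: card_lists_length_eq card_cartesian_product)
  have finT: "finite ?T" using J C by (simp add: finite_lists_length_eq)
  have fstI: "fst ` set xs \<subseteq> I - {K}" if "xs \<in> ?L" for xs using that J by fastforce
  have "?E = (\<Union>(xs, b)\<in>?T. relation_event P K xs b)" by auto
  also have "emeasure P \<dots> \<le> (\<Sum>(xs, b)\<in>?T. emeasure P (relation_event P K xs b))"
    unfolding split_def
  proof (rule emeasure_subadditive_finite[OF finT])
    show "(\<lambda>p. relation_event P K (fst p) (snd p)) ` ?T \<subseteq> sets P"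
      unfolding P_def using fstI K by (force intro!: sets_relation_event)
  qed
  also have "\<dots> \<le> (\<Sum>(xs, b)\<in>?T. ennreal (1 / card (B K)))"
    unfolding P_def using B fstI K
    by (intro sum_mono) (auto intro!: emeasure_relation_event_le)
  also have "\<dots> = ennreal (real (card ?T) * (1 / card (B K)))"
    by (simp add: split_def ennreal_mult[symmetric] ennreal_of_nat_eq_real_of_nat)
  also have "\<dots> \<le> ennreal (real ((card J * card C) ^ R * card C) / card (B K))"
  proof (rule ennreal_leI)
    have "card ?T \<le> (card J * card C) ^ R * card C"
      unfolding card_cartesian_product cardL by (intro mult_left_mono card_Diff1_le) auto
    then show "real (card ?T) * (1 / card (B K))
        \<le> real ((card J * card C) ^ R * card C) / card (B K)"
      unfolding times_divide_eq_right mult_1_right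
      by (intro divide_right_mono) (simp_all only: of_nat_le_iff of_nat_0_le_iff)
  qed
  finally show ?thesis .
qed

subsection \<open>Block sizes and the counting estimate\<close>

lemma finite_block_ints: "finite (block_ints a \<omega> k)"
proof (rule finite_subset)
  show "block_ints a \<omega> k \<subseteq> {..nat \<lceil>max a (a * real k powr \<omega> k)\<rceil>}"
    unfolding block_ints_def block_def by (auto split: if_splits) linarith+
qed simp

text \<open>The integers from the ceiling of \<open>x\<close> up to, but excluding, the ceiling of
  \<open>y\<close> all qualify; rounding \<open>x\<close> up costs at most 1.\<close>

lemma card_nat_interval_ge:
  fixes x y :: real
  assumes "0 < x"
  shows "y - x - 1 \<le> real (card {m::nat. m > 0 \<and> x \<le> real m \<and> real m < y})"
proof -
  have "{nat \<lceil>x\<rceil>..<nat \<lceil>y\<rceil>} \<subseteq> {m::nat. m > 0 \<and> x \<le> real m \<and> real m < y}"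
  proof
    fix m assume "m \<in> {nat \<lceil>x\<rceil>..<nat \<lceil>y\<rceil>}"
    then have "x \<le> real m" "real m < y" by (auto simp: nat_ceiling_le_eq) linarith
    then show "m \<in> {m::nat. m > 0 \<and> x \<le> real m \<and> real m < y}"
      using assms by (cases m) auto
  qed
  moreover have "finite {m::nat. m > 0 \<and> x \<le> real m \<and> real m < y}"
    by (rule finite_subset[of _ "{..nat \<lceil>y\<rceil>}"]) (auto, linarith)
  ultimately have "nat \<lceil>y\<rceil> - nat \<lceil>x\<rceil> \<le> card {m::nat. m > 0 \<and> x \<le> real m \<and> real m < y}"
    using card_mono[of "{m::nat. m > 0 \<and> x \<le> real m \<and> real m < y}" "{nat \<lceil>x\<rceil>..<nat \<lceil>y\<rceil>}"] by simp
  moreover have "\<lceil>y\<rceil> - \<lceil>x\<rceil> \<le> int (nat \<lceil>y\<rceil> - nat \<lceil>x\<rceil>)"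
    using assms by linarith
  ultimately have "\<lceil>y\<rceil> - \<lceil>x\<rceil> \<le> int (card {m::nat. m > 0 \<and> x \<le> real m \<and> real m < y})"
    by linarith
  then show ?thesis using le_of_int_ceiling[of y] of_int_ceiling_le_add_one[of x] by linarith
qed

text \<open>Replacing the exponent \<omega>(K-1) by w = \<omega>(K) and splitting off one factor K-1
  shows that the block has length at least \<open>a * K powr (w - 1)\<close>. Since
  \<open>a * K \<ge> 2\<close>, this is at least two copies of
  \<open>K powr (w - 2)\<close>.\<close>

lemma card_block_ints_ge:
  assumes "growth_seq \<omega>" "a > 0" "K \<ge> 2" "\<omega> K \<ge> 2" "a * real K \<ge> 2"
  shows "real K powr (\<omega> K - 2) \<le> real (card (block_ints a \<omega> K))"
proof -
  define w where "w = \<omega> K"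
  have le: "\<omega> (K - 1) \<le> w"
    using assms(1,3) unfolding growth_seq_def w_def by (auto intro!: mono_onD[of "{1..}" \<omega>])
  have K: "real K \<ge> 2" "real (K - 1) = real K - 1" using assms(3) by auto
  have "real (K - 1) powr \<omega> (K - 1) \<le> real (K - 1) powr w"
    using le K by (intro powr_mono) auto
  also have "\<dots> = real (K - 1) powr (w - 1) * real (K - 1)"
    using K by (simp add: powr_diff)
  also have "\<dots> \<le> real K powr (w - 1) * (real K - 1)"
    using K assms(4) unfolding w_def by (intro mult_mono powr_mono2) auto
  also have "\<dots> = real K powr w - real K powr (w - 1)"
    using K by (simp add: powr_diff field_simps)
  finally have "a * real (K - 1) powr \<omega> (K - 1) \<le> a * (real K powr w - real K powr (w - 1))"
    using assms(2) by simp
  moreover have "a * real K powr (w - 1) \<ge> 2 * real K powr (w - 2)"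
  proof -
    have "real K powr (w - 1) = real K * real K powr (w - 2)"
      using K powr_add[of "real K" 1 "w - 2"] by simp
    then show ?thesis using assms(5) mult_right_mono[of 2 "a * real K" "real K powr (w - 2)"]
      by (simp add: mult.assoc)
  qed
  \<comment> \<open>The second copy of \<open>K powr (w - 2)\<close> pays for the 1 lost in
    rounding.\<close>
  moreover have "real K powr (w - 2) \<ge> 1"
    using K assms(4) unfolding w_def by (intro ge_one_powr_ge_zero) auto
  moreover have "a * real K powr w - a * real (K - 1) powr \<omega> (K - 1) - 1
      \<le> real (card (block_ints a \<omega> K))"
  proof -
    have "block_ints a \<omega> K = {m. m > 0 \<and> a * real (K - 1) powr \<omega> (K - 1) \<le> real m \<and>
        real m < a * real K powr w}"
      using assms(3) unfolding block_ints_def block_def w_def by auto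
    moreover have "0 < a * real (K - 1) powr \<omega> (K - 1)" using assms(2) K by simp
    ultimately show ?thesis by (simp add: card_nat_interval_ge)
  qed
  ultimately show ?thesis unfolding w_def[symmetric] by (simp add: right_diff_distrib)
qed

text \<open>With t = sqrt w / 2 the count is at most K to the power (t+2)t + (t+1), while w = 4t^2.
  The target exponent \<open>w - 4\<close> lies 2 below that of the block size, which leaves the
  summable \<open>K powr (-2)\<close>.\<close>

lemma relation_count_le:
  fixes w :: real and K :: nat
  assumes "w \<ge> 36" "K \<ge> 3"
  defines "C \<equiv> {- \<lfloor>real K powr (sqrt w / 2)\<rfloor>..\<lfloor>real K powr (sqrt w / 2)\<rfloor>}"
  shows "real ((card {1..<K} * card C) ^ nat \<lfloor>sqrt w / 2\<rfloor> * card C) \<le> real K powr (w - 4)"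
proof -
  define t where "t = sqrt w / 2"
  have w: "w = 4 * t^2" using assms(1) by (simp add: t_def power_divide)
  have t: "t \<ge> 3"
    using real_sqrt_le_mono[OF assms(1)] real_sqrt_unique[of 6 36] unfolding t_def by simp
  have K: "real K \<ge> 3" using assms(2) by simp
  have Kt: "real K powr t \<ge> 1" using K t by (intro ge_one_powr_ge_zero) auto
  have "real (card C) = 2 * real_of_int \<lfloor>real K powr t\<rfloor> + 1"
    using Kt unfolding C_def t_def[symmetric] by simp
  \<comment> \<open>The left side is at most \<open>3 * K powr t\<close>, and
    \<open>K \<ge> 3\<close> absorbs the constant.\<close>
  also have "\<dots> \<le> real K * real K powr t"
    using Kt K mult_right_mono[of 3 "real K" "real K powr t"] by linarith
  also have "\<dots> = real K powr (t + 1)" using K by (simp add: powr_add)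
  finally have cC: "real (card C) \<le> real K powr (t + 1)" .
  have "real (card {1..<K} * card C) \<le> real K * real K powr (t + 1)"
    unfolding of_nat_mult using cC by (intro mult_mono) auto
  also have "\<dots> = real K powr (t + 2)"
    using K powr_add[of "real K" 1 "t + 1"] by (simp add: add.commute)
  finally have "real (card {1..<K} * card C) ^ nat \<lfloor>t\<rfloor> \<le> (real K powr (t + 2)) ^ nat \<lfloor>t\<rfloor>"
    by (intro power_mono) auto
  also have "\<dots> = real K powr ((t + 2) * real (nat \<lfloor>t\<rfloor>))"
    using K by (simp add: powr_powr[symmetric] powr_realpow)
  also have "\<dots> \<le> real K powr ((t + 2) * t)"
    using K t by (intro powr_mono mult_left_mono) auto
  finally have "real ((card {1..<K} * card C) ^ nat \<lfloor>t\<rfloor> * card C)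
      \<le> real K powr ((t + 2) * t) * real K powr (t + 1)"
    unfolding of_nat_mult of_nat_power using cC by (intro mult_mono) auto
  also have "\<dots> = real K powr ((t + 2) * t + (t + 1))" by (simp add: powr_add)
  also have "\<dots> \<le> real K powr (w - 4)"
  proof (rule powr_mono)
    \<comment> \<open>The hypothesis \<open>w \<ge> 36\<close> means t \<ge> 3, so the linear term
      3t is bounded by t^2 and the rest of 4t^2 covers the constants.\<close>
    have "t * t \<ge> 3 * t" using t by (intro mult_right_mono) auto
    moreover have "(t + 2) * t + (t + 1) = t * t + 3 * t + 1" by (simp add: algebra_simps)
    moreover have "w = 4 * (t * t)" unfolding w power2_eq_square ..
    ultimately show "(t + 2) * t + (t + 1) \<le> w - 4" using t by linarith
  qed (use K in auto)
  finally show ?thesis unfolding t_def .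
qed

subsection \<open>The order of the random sequence\<close>

lemma block_ints_less_Suc:
  assumes "x \<in> block_ints a \<omega> k" "y \<in> block_ints a \<omega> (Suc k)" "k \<ge> 1"
  shows "x < y"
proof -
  \<comment> \<open>For \<open>k = 1\<close> the separately defined upper end \<open>a\<close>
    agrees with this formula, since powers of 1 are 1.\<close>
  have "real x < a * real k powr \<omega> k"
    using assms(1) unfolding block_ints_def block_def by (auto split: if_splits)
  also have "\<dots> \<le> real y"
    using assms(2,3) unfolding block_ints_def block_def by (auto split: if_splits)
  finally show ?thesis by simp
qed

lemma enumerate_strict_mono_image:
  fixes f :: "nat \<Rightarrow> nat"
  assumes "strict_mono f"
  shows "enumerate (range f) i = f i"
proof -
  have inf: "infinite (range f)"
    using assms by (simp add: finite_image_iff strict_mono_imp_inj_on)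
  show ?thesis
  proof (induction i)
    case 0
    have "(LEAST m. m \<in> range f) = f 0"
      using assms by (intro Least_equality) (auto simp: strict_mono_less_eq)
    then show ?case by (simp add: enumerate_0)
  next
    case (Suc i)
    have "(LEAST s. s \<in> range f \<and> f i < s) = f (Suc i)"
      using assms by (intro Least_equality) (auto simp: strict_mono_less strict_mono_less_eq Suc_le_eq)
    then show ?case using inf Suc by (simp add: enumerate_Suc'')
  qed
qed

text \<open>This turns membership among the \<open>N\<close> smallest values into the index
  condition \<open>k \<le> N\<close>. The shift by \<open>Suc\<close> reconciles indices from 1 with
  an enumeration from 0.\<close>

lemma smallest_elems_strict_mono:
  fixes n :: "nat \<Rightarrow> nat"
  assumes "strict_mono (\<lambda>i. n (Suc i))"
  shows "smallest_elems N (n ` {1..}) = n ` {1..N}"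
proof -
  have r: "n ` {1..} = range (\<lambda>i. n (Suc i))"
    by (auto simp: image_iff) (metis Suc_le_D)
  show ?thesis
    unfolding smallest_elems_def r enumerate_strict_mono_image[OF assms]
    by (simp only: image_Suc_lessThan[symmetric] image_image)
qed

subsection \<open>Relations violating the condition\<close>

text \<open>Removing term \<open>j\<close> leaves \<open>r - 1\<close> terms, which fit into
  \<open>R\<close> places; the rest is filled with zero coefficients at the dummy index
  \<open>j0\<close>.\<close>

lemma padded_relation_list:
  fixes k :: "nat \<Rightarrow> nat" and d :: "nat \<Rightarrow> int" and n :: "nat \<Rightarrow> nat"
  assumes j: "j \<in> {1..r}" and r: "r \<le> Suc R" and J: "j0 \<in> J" "0 \<in> C"
    and k: "\<And>i. i \<in> {1..r} - {j} \<Longrightarrow> k i \<in> J \<and> d i \<in> C"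
    and rel: "(\<Sum>i=1..r. d i * int (n (k i))) = 0"
  obtains xs where "set xs \<subseteq> J \<times> C" "length xs = R"
    "(\<Sum>(k, d)\<leftarrow>xs. d * int (n k)) + d j * int (n (k j)) = 0"
proof -
  obtain js where js: "set js = {1..r} - {j}" "distinct js"
    using finite_distinct_list[of "{1..r} - {j}"] by auto
  define xs where "xs = map (\<lambda>i. (k i, d i)) js @ replicate (R - length js) (j0, 0)"
  have len: "length js = r - 1"
    using distinct_card[OF js(2)] j unfolding js by simp
  have "(\<Sum>(k, d)\<leftarrow>xs. d * int (n k)) = (\<Sum>i\<in>{1..r} - {j}. d i * int (n (k i)))"
    using js unfolding xs_def
    by (simp add: o_def sum_list_distinct_conv_sum_set sum_list_replicate)
  then have "(\<Sum>(k, d)\<leftarrow>xs. d * int (n k)) + d j * int (n (k j)) = 0"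
    using rel sum.remove[OF _ j, of "\<lambda>i. d i * int (n (k i))"] by simp
  moreover have "set xs \<subseteq> J \<times> C" using k J js(1) unfolding xs_def by auto
  moreover have "length xs = R" using len r unfolding xs_def by simp
  ultimately show ?thesis using that by blast
qed

text \<open>Zero coefficients are allowed in \<open>xs\<close>, so that lists of one fixed length cover all shorter relations.\<close>

definition bad_event :: "(nat \<Rightarrow> nat) measure \<Rightarrow> (nat \<Rightarrow> real) \<Rightarrow> nat \<Rightarrow> (nat \<Rightarrow> nat) set" where
  "bad_event P \<eta> K =
     (let C = {- \<lfloor>real K powr \<eta> K\<rfloor>..\<lfloor>real K powr \<eta> K\<rfloor>}
      in \<Union>xs\<in>{xs. set xs \<subseteq> {1..<K} \<times> C \<and> length xs = nat \<lfloor>\<eta> K\<rfloor>}. \<Union>b\<in>C - {0}.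
           relation_event P K xs b)"

text \<open>Passing to the largest index \<open>K\<close> of the relation removes the dependence on
  \<open>N\<close>: both the length bound and the coefficient bound only grow from \<open>N\<close>
  to \<open>K\<close>. One event for each \<open>K\<close> thus covers the violations at all stages
  \<open>N < K\<close>.\<close>

lemma bad_event_of_relation:
  fixes k :: "nat \<Rightarrow> nat" and d :: "nat \<Rightarrow> int"
  assumes n: "n \<in> space P" and \<eta>: "mono_on {1..} \<eta>" "\<And>k. k \<ge> 1 \<Longrightarrow> \<eta> k > 0"
    and N: "N \<ge> 1" and r: "real r \<le> \<eta> N"
    and k: "\<forall>i\<in>{1..r}. k i \<ge> 1" "inj_on k {1..r}"
    and d: "\<forall>i\<in>{1..r}. 0 < \<bar>d i\<bar> \<and> real_of_int \<bar>d i\<bar> \<le> real N powr \<eta> N"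
    and rel: "(\<Sum>i=1..r. d i * int (n (k i))) = 0"
    and i: "i \<in> {1..r}" "k i > N"
  shows "\<exists>K>N. n \<in> bad_event P \<eta> K"
proof -
  define K where "K = Max (k ` {1..r})"
  have "K \<in> k ` {1..r}" unfolding K_def using i by (intro Max_in) auto
  then obtain j where j: "j \<in> {1..r}" "k j = K" by auto
  have le: "k i' \<le> K" if "i' \<in> {1..r}" for i' unfolding K_def using that by simp
  have K: "K > N" using le[OF i(1)] i(2) by simp
  have \<eta>le: "\<eta> N \<le> \<eta> K" using \<eta>(1) K N by (auto intro: mono_onD)
  define C where "C = {- \<lfloor>real K powr \<eta> K\<rfloor>..\<lfloor>real K powr \<eta> K\<rfloor>}"
  have "real N powr \<eta> N \<le> real K powr \<eta> N"
    using K \<eta>(2)[OF N] by (intro powr_mono2) auto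
  also have "\<dots> \<le> real K powr \<eta> K" using K N \<eta>le by (intro powr_mono) auto
  finally have Npow: "real N powr \<eta> N \<le> real K powr \<eta> K" .
  have dC: "d i' \<in> C - {0}" if "i' \<in> {1..r}" for i'
  proof -
    have "0 < \<bar>d i'\<bar> \<and> real_of_int \<bar>d i'\<bar> \<le> real N powr \<eta> N" using d that by (rule bspec)
    then have "real_of_int \<bar>d i'\<bar> \<le> real K powr \<eta> K" "d i' \<noteq> 0"
      using Npow by auto
    then have "\<bar>d i'\<bar> \<le> \<lfloor>real K powr \<eta> K\<rfloor>" by (simp add: le_floor_iff)
    then show ?thesis using \<open>d i' \<noteq> 0\<close> unfolding C_def by auto
  qed
  have rR: "r \<le> Suc (nat \<lfloor>\<eta> K\<rfloor>)" using r \<eta>le by linarith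
  \<comment> \<open>Index 1 serves as the dummy index for padding; it lies below \<open>K\<close>
    because \<open>K > N \<ge> 1\<close>.\<close>
  have C: "1 \<in> {1..<K}" "0 \<in> C" using K N unfolding C_def by auto
  have kC: "k i' \<in> {1..<K} \<and> d i' \<in> C" if "i' \<in> {1..r} - {j}" for i'
  proof -
    \<comment> \<open>Distinctness of the indices makes the maximum strict, so the other terms do
      not involve \<open>n K\<close>.\<close>
    have "k i' \<noteq> K" using that j inj_onD[OF k(2), of i' j] by auto
    moreover have "k i' \<ge> 1" "k i' \<le> K" "d i' \<in> C" using that le[of i'] k(1) dC[of i'] by auto
    ultimately show ?thesis by simp
  qed
  obtain xs where xs: "set xs \<subseteq> {1..<K} \<times> C" "length xs = nat \<lfloor>\<eta> K\<rfloor>"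
    "(\<Sum>(k, d)\<leftarrow>xs. d * int (n k)) + d j * int (n (k j)) = 0"
    using padded_relation_list[OF j(1) rR C kC rel] .
  have "n \<in> relation_event P K xs (d j)"
    using n xs(3) unfolding relation_event_def j(2) by blast
  then have "n \<in> bad_event P \<eta> K"
    using xs(1,2) dC[OF j(1)] unfolding bad_event_def Let_def C_def[symmetric] by blast
  then show ?thesis using K by blast
qed

text \<open>The deterministic half: past the last bad \<open>K\<close>, a relation at stage
  \<open>N\<close> cannot use an index above \<open>N\<close>, and the sequence is
  increasing.\<close>

lemma condition_A_of_finitely_many_bad:
  assumes n: "n \<in> space P" "\<And>k. k \<ge> 1 \<Longrightarrow> n k \<in> block_ints a \<omega> k"
    and \<eta>: "mono_on {1..} \<eta>" "\<And>k. k \<ge> 1 \<Longrightarrow> \<eta> k > 0"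
    and ev: "eventually (\<lambda>K. n \<notin> bad_event P \<eta> K) sequentially"
  shows "condition_A \<eta> n"
proof -
  have sm: "strict_mono (\<lambda>i. n (Suc i))"
    unfolding strict_mono_Suc_iff using n(2) block_ints_less_Suc by fastforce
  have "inj_on n {1..}"
  proof (rule inj_onI)
    fix x y assume "x \<in> {1::nat..}" "y \<in> {1..}" "n x = n y"
    then show "x = y"
      using strict_mono_eq[OF sm, of "x - 1" "y - 1"] by auto
  qed
  moreover have "\<forall>k\<ge>1. n k > 0" using n(2) unfolding block_ints_def by auto
  moreover obtain N0 where N0: "\<And>K. K \<ge> N0 \<Longrightarrow> n \<notin> bad_event P \<eta> K"
    using ev unfolding eventually_sequentially by blast
  have "n (k i) \<in> smallest_elems N (n ` {1..})"
    if h: "N \<ge> max N0 1" "real r \<le> \<eta> N" "\<forall>i\<in>{1..r}. k i \<ge> 1" "inj_on k {1..r}"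
      "\<forall>i\<in>{1..r}. 0 < \<bar>d i\<bar> \<and> real_of_int \<bar>d i\<bar> \<le> real N powr \<eta> N"
      "(\<Sum>i=1..r. d i * int (n (k i))) = 0" "i \<in> {1..r}"
    for N r i :: nat and k :: "nat \<Rightarrow> nat" and d :: "nat \<Rightarrow> int"
  proof -
    have "\<not> k i > N"
    proof
      assume "k i > N"
      then obtain K where "K > N" "n \<in> bad_event P \<eta> K"
        using bad_event_of_relation[OF n(1) \<eta> _ h(2-7)] h(1) by auto
      then show False using N0[of K] h(1) by auto
    qed
    then show ?thesis
      unfolding smallest_elems_strict_mono[OF sm] using h(3,7) by auto
  qed
  then have "\<exists>N0\<ge>1. \<forall>N\<ge>N0. \<forall>(r::nat) (k :: nat \<Rightarrow> nat) (a :: nat \<Rightarrow> int).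
        2 \<le> r \<longrightarrow> real r \<le> \<eta> N \<longrightarrow>
        (\<forall>i\<in>{1..r}. k i \<ge> 1) \<longrightarrow> inj_on k {1..r} \<longrightarrow>
        (\<forall>i\<in>{1..r}. 0 < \<bar>a i\<bar> \<and> real_of_int \<bar>a i\<bar> \<le> real N powr \<eta> N) \<longrightarrow>
        (\<Sum>i=1..r. a i * int (n (k i))) = 0 \<longrightarrow>
        (\<forall>i\<in>{1..r}. n (k i) \<in> smallest_elems N (n ` {1..}))"
    by (intro exI[of _ "max N0 1"]) simp
  ultimately show ?thesis unfolding condition_A_def by blast
qed

section \<open>Summability of the bad events and Borel-Cantelli\<close>

theorem mainTheorem4:
  "\<exists>c::real. c > 0 \<and>
     (\<forall>(\<omega> :: nat \<Rightarrow> real) (a :: real).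
        growth_seq \<omega> \<longrightarrow> a > 0 \<longrightarrow> (\<forall>k\<ge>1. block_ints a \<omega> k \<noteq> {}) \<longrightarrow>
        (AE n in mu a \<omega>. condition_A (\<lambda>k. c * sqrt (\<omega> k)) n))"
proof (intro exI[of _ "1/2"] conjI allI impI)
  fix \<omega> :: "nat \<Rightarrow> real" and a :: real
  assume \<omega>: "growth_seq \<omega>" and a: "a > 0" and ne: "\<forall>k\<ge>1. block_ints a \<omega> k \<noteq> {}"
  define \<eta> where "\<eta> = (\<lambda>k. 1/2 * sqrt (\<omega> k))"
  define P where "P = mu a \<omega>"
  have P: "P = PiM {1..} (\<lambda>k. uniform_count_measure (block_ints a \<omega> k))"
    unfolding P_def mu_def ..
  have B: "finite (block_ints a \<omega> k) \<and> block_ints a \<omega> k \<noteq> {}" if "k \<in> {1..}" for k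
    using ne that finite_block_ints by auto
  interpret prob_space P
    unfolding P using B by (intro prob_space_PiM prob_space_uniform_count_measure) auto
  have meas: "bad_event P \<eta> K \<in> sets P" if "K \<ge> 1" for K
    unfolding bad_event_def Let_def
  proof (intro sets.finite_UN)
    fix xs b assume "xs \<in> {xs. set xs \<subseteq> {1..<K} \<times> {- \<lfloor>real K powr \<eta> K\<rfloor>..\<lfloor>real K powr \<eta> K\<rfloor>}
        \<and> length xs = nat \<lfloor>\<eta> K\<rfloor>}"
    then show "relation_event P K xs b \<in> sets P"
      unfolding P using that by (intro sets_relation_event) force+
  qed (simp_all add: finite_lists_length_eq)
  have bound: "measure P (bad_event P \<eta> K) \<le> real K powr (-2)"
    if K: "K \<ge> 3" "\<omega> K \<ge> 36" "a * real K \<ge> 2" for K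
  proof -
    define C where "C = {- \<lfloor>real K powr (sqrt (\<omega> K) / 2)\<rfloor>..\<lfloor>real K powr (sqrt (\<omega> K) / 2)\<rfloor>}"
    let ?c = "real (card (block_ints a \<omega> K))"
    let ?q = "real ((card {1..<K} * card C) ^ nat \<lfloor>sqrt (\<omega> K) / 2\<rfloor> * card C)"
    have \<eta>K: "\<eta> K = sqrt (\<omega> K) / 2" unfolding \<eta>_def by simp
    have C: "finite C" "0 \<in> C" unfolding C_def by simp_all
    have "emeasure P (bad_event P \<eta> K) \<le> ennreal (?q / ?c)"
      unfolding P bad_event_def Let_def \<eta>K C_def[symmetric]
      by (rule emeasure_Union_relation_event_le[OF B _ _ _ C]) (use K(1) in auto)
    then have "measure P (bad_event P \<eta> K) \<le> ?q / ?c"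
      by (simp add: emeasure_eq_measure)
    also have "\<dots> \<le> real K powr (\<omega> K - 4) / real K powr (\<omega> K - 2)"
      using card_block_ints_ge[OF \<omega> a, of K] relation_count_le[OF K(2,1)] K
      unfolding C_def by (intro frac_le) auto
    also have "\<dots> = real K powr (-2)"
      using K(1) by (subst powr_diff[symmetric]) simp
    finally show ?thesis .
  qed
  have "eventually (\<lambda>K. \<omega> K \<ge> 36) sequentially"
    using \<omega> unfolding growth_seq_def filterlim_at_top by blast
  \<comment> \<open>The threshold \<open>2 / a\<close> ensures \<open>a * K \<ge> 2\<close>, as the
    block size estimate requires.\<close>
  moreover have "eventually (\<lambda>K. K \<ge> max 3 (nat \<lceil>2 / a\<rceil>)) sequentially"
    by (rule eventually_ge_at_top)
  ultimately have "eventually (\<lambda>K. norm (measure P (bad_event P \<eta> K)) \<le> real K powr (-2)) sequentially"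
  proof eventually_elim
    case (elim K)
    have "2 / a \<le> real K" using elim(2) by (simp add: nat_ceiling_le_eq)
    then show ?case using bound[of K] elim a by (simp add: field_simps)
  qed
  then have "summable (\<lambda>K. measure P (bad_event P \<eta> K))"
    by (rule summable_comparison_test_ev) (simp add: summable_real_powr_iff)
  \<comment> \<open>Measurability of the bad events is established for \<open>K \<ge> 1\<close>, the
    coordinates of the product, so Borel-Cantelli is applied to the shifted sequence.\<close>
  then have "summable (\<lambda>K. measure P (bad_event P \<eta> (Suc K)))"
    by (subst summable_Suc_iff)
  then have "AE n in P. eventually (\<lambda>K. n \<in> space P - bad_event P \<eta> (Suc K)) sequentially"
    using meas by (intro borel_cantelli_AE1) (auto simp: emeasure_eq_measure)
  then show "AE n in mu a \<omega>. condition_A (\<lambda>k. 1/2 * sqrt (\<omega> k)) n"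
    unfolding P_def[symmetric] \<eta>_def[symmetric]
  proof (rule AE_mp, intro AE_I2 impI)
    fix n assume n: "n \<in> space P"
      and ev: "eventually (\<lambda>K. n \<in> space P - bad_event P \<eta> (Suc K)) sequentially"
    have "n k \<in> block_ints a \<omega> k" if "k \<ge> 1" for k
      using n that unfolding P by (auto simp: space_PiM space_uniform_count_measure PiE_iff)
    moreover have "mono_on {1..} \<eta>"
      using \<omega> unfolding growth_seq_def \<eta>_def by (auto simp: mono_on_def)
    moreover have "\<eta> k > 0" if "k \<ge> 1" for k
      using \<omega> that unfolding growth_seq_def \<eta>_def by simp
    moreover have "eventually (\<lambda>K. n \<notin> bad_event P \<eta> (Suc K)) sequentially"
      using ev by (rule eventually_mono) simp
    then have "eventually (\<lambda>K. n \<notin> bad_event P \<eta> K) sequentially"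
      by (rule eventually_sequentially_Suc[THEN iffD1])
    ultimately show "condition_A \<eta> n"
      using n by (intro condition_A_of_finitely_many_bad[of n P]) auto
  qed
qed simp

end
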